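(* Let $G=(A,R,C)$ be an abstract dialectical framework and let $F=(A,R,f_Q)\in\Delta[G]$ be such that there is no $F'\in\Delta[G]$ with $F'\sqsubset F$. Then for every $\lambda$ in the ADF-grounded semantics of $F$ there exists $\lambda'$ in the ADF-grounded semantics of $G$ with $\lambda\preceq\lambda'$.
   Context: Labels: $\mathcal{L}=\{\mathsf{in},\mathsf{out},\mathsf{undec}\}$. For a finite set $S$ of arguments, $\Lambda^S$ is the set of total functions $S\to\mathcal{L}$. For labellings $\lambda_1,\lambda_2$: $\lambda_1\preceq\lambda_2$ iff both are in $\Lambda^S$ for the same finite $S$ and, for every $a\in S$, $\lambda_1(a)=\mathsf{in}$ implies $\lambda_2(a)=\mathsf{in}$ and $\lambda_1(a)=\mathsf{out}$ implies $\lambda_2(a)=\mathsf{out}$. A nuance tuple is $((n_1,n_2),(m_1,m_2))\in\mathbb{N}^4$ with $n_1\le n_2$, $m_1\le m_2$. A may-must argumentation (MMA) is $(A,R,f_Q)$ with $A$ finite, $R\subseteq A\times A$, $f_Q$ assigning a nuance tuple to each argument. $\mathrm{pre}(a)=\{b\in A:(b,a)\in R\}$. For $\lambda$ a labelling, $o_\lambda(a)$ (resp. $i_\lambda(a)$) is the number of $b\in\mathrm{pre}(a)$ with $\lambda(b)=\mathsf{out}$ (resp. $\mathsf{in}$). With $f_Q(a)=((n_1,n_2),(m_1,m_2))$: may-a iff $n_1\le o_\lambda(a)$; must-a iff $n_2\le o_\lambda(a)$; may$_s$-a iff $n_1\le o_\lambda(a)<n_2$; not-a iff $o_\lambda(a)<n_1$;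 may-r, must-r, may$_s$-r, not-r likewise with $m_1,m_2,i_\lambda(a)$. $\lambda$ designates $l$ for $a$ in the MMA iff $\lambda$ is defined on all of $\mathrm{pre}(a)$ and: $l=\mathsf{in}$ requires may-a and not must-r; $l=\mathsf{out}$ requires may-r and not must-a; $l=\mathsf{undec}$ requires (must-a and must-r) or may$_s$-a or may$_s$-r or (not-a and not-r). An abstract dialectical framework (ADF) is $(A,R,C)$ with $C=(C_a)_{a\in A}$, $C_a:\Lambda^{\mathrm{pre}(a)}\to\mathcal{L}$; $\lambda$ designates $l$ for $a$ in the ADF iff $\lambda$ is defined on $\mathrm{pre}(a)$ and $C_a(\lambda|_{\mathrm{pre}(a)})=l$. ADF-grounded semantics: for $Y$ an MMA or ADF with argument set $A$ and $\lambda\in\Lambda^A$, let $\mathrm{max}_A(\lambda)$ be the set of $\preceq$-maximal elements $\lambda_x$ of $\Lambda^A$ with $\lambda\preceq\lambda_x$ (these take only values $\mathsf{in},\mathsf{out}$). Define $\Theta^Y(\lambda)\in\Lambda^A$ by: for $l\in\{\mathsf{in},\mathsf{out}\}$, $\Theta^Y(\lambda)(a)=l$ iff every $\lambda_x\in\mathrm{max}_A(\lambda)$ designates $l$ and no other label for $a$ in $Y$; otherwise $\Theta^Y(\lambda)(a)=\mathsf{undec}$. The ADF-grounded semantics of $Y$ is the set containing just the $\preceq$-least fixpoint of $\Theta^Y$. $\Delta[G]$ (abstractions of ADF $G=(A,R,C)$): all MMAs $(A,R,f_Q)$ such that for every $a$, with $f_Q(a)=((n_1,n_2),(m_1,m_2))$,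 $n_2,m_2\le|\mathrm{pre}(a)|+1$, and for every $\lambda\in\Lambda^{\mathrm{pre}(a)}$, with $o=o_\lambda(a),i=i_\lambda(a)$: $o<n_1,i<m_1\Rightarrow C_a(\lambda)=\mathsf{undec}$; $n_1\le o<n_2,i<m_1\Rightarrow C_a(\lambda)\in\{\mathsf{in},\mathsf{undec}\}$; $n_2\le o,i<m_1\Rightarrow\mathsf{in}$; $o<n_1,m_1\le i<m_2\Rightarrow\{\mathsf{out},\mathsf{undec}\}$; $n_1\le o<n_2,m_1\le i<m_2\Rightarrow$ arbitrary; $n_2\le o,m_1\le i<m_2\Rightarrow\{\mathsf{in},\mathsf{undec}\}$; $o<n_1,m_2\le i\Rightarrow\mathsf{out}$; $n_1\le o<n_2,m_2\le i\Rightarrow\{\mathsf{out},\mathsf{undec}\}$; $n_2\le o,m_2\le i\Rightarrow\mathsf{undec}$. Order: $((n_1,n_2),(m_1,m_2))\unlhd((n_1',n_2'),(m_1',m_2'))$ iff $n_1'\le n_1$, $n_2\le n_2'$, $m_1'\le m_1$, $m_2\le m_2'$; $(A,R,f_Q)\sqsubseteq(A,R,f'_Q)$ iff $f_Q(a)\unlhd f'_Q(a)$ for all $a$; $F'\sqsubset F$ iff $F'\sqsubseteq F$ and not $F\sqsubseteq F'$. *)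

theory Defs
  imports Main
begin

datatype label = In | Out | Undec

text \<open>A labelling of a finite set \<open>S\<close> of arguments is a partial map whose domain is \<open>S\<close>.\<close>

type_synonym 'a labelling = "'a \<rightharpoonup> label"

definition labellings :: "'a set \<Rightarrow> 'a labelling set" where
  "labellings S = {l. dom l = S}"

definition lab_le :: "'a labelling \<Rightarrow> 'a labelling \<Rightarrow> bool" (infix "\<preceq>" 50) where
  "l1 \<preceq> l2 \<longleftrightarrow> finite (dom l1) \<and> dom l1 = dom l2 \<and>
     (\<forall>a\<in>dom l1. (l1 a = Some In \<longrightarrow> l2 a = Some In) \<and> (l1 a = Some Out \<longrightarrow> l2 a = Some Out))"

type_synonym nuance = "(nat \<times> nat) \<times> (nat \<times> nat)"

text \<open>
  The fields \<open>nuance\<close> and \<open>cond\<close> are total functions; only the values \<open>nuance F a\<close> and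
  \<open>cond G a l\<close> with \<open>a\<close> an argument and \<open>l\<close> a labelling of its predecessors are meaningful,
  and everything below depends on these values only.
\<close>

record 'a frame =
  args :: "'a set"
  att :: "('a \<times> 'a) set"

record 'a mma = "'a frame" +
  nuance :: "'a \<Rightarrow> nuance"

record 'a adf = "'a frame" +
  cond :: "'a \<Rightarrow> 'a labelling \<Rightarrow> label"

definition is_nuance :: "nuance \<Rightarrow> bool" where
  "is_nuance q \<longleftrightarrow> (case q of ((n1, n2), (m1, m2)) \<Rightarrow> n1 \<le> n2 \<and> m1 \<le> m2)"

definition is_mma :: "'a mma \<Rightarrow> bool" where
  "is_mma F \<longleftrightarrow> finite (args F) \<and> att F \<subseteq> args F \<times> args F \<and>
     (\<forall>a\<in>args F. is_nuance (nuance F a))"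

definition is_adf :: "'a adf \<Rightarrow> bool" where
  "is_adf G \<longleftrightarrow> finite (args G) \<and> att G \<subseteq> args G \<times> args G"

definition pre :: "('a, 'b) frame_scheme \<Rightarrow> 'a \<Rightarrow> 'a set" where
  "pre Y a = {b \<in> args Y. (b, a) \<in> att Y}"

definition n_out :: "('a, 'b) frame_scheme \<Rightarrow> 'a labelling \<Rightarrow> 'a \<Rightarrow> nat" where
  "n_out Y l a = card {b \<in> pre Y a. l b = Some Out}"

definition n_in :: "('a, 'b) frame_scheme \<Rightarrow> 'a labelling \<Rightarrow> 'a \<Rightarrow> nat" where
  "n_in Y l a = card {b \<in> pre Y a. l b = Some In}"

definition may_a :: "'a mma \<Rightarrow> 'a labelling \<Rightarrow> 'a \<Rightarrow> bool" where
  "may_a F l a \<longleftrightarrow> fst (fst (nuance F a)) \<le> n_out F l a"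

definition must_a :: "'a mma \<Rightarrow> 'a labelling \<Rightarrow> 'a \<Rightarrow> bool" where
  "must_a F l a \<longleftrightarrow> snd (fst (nuance F a)) \<le> n_out F l a"

definition mays_a :: "'a mma \<Rightarrow> 'a labelling \<Rightarrow> 'a \<Rightarrow> bool" where
  "mays_a F l a \<longleftrightarrow>
     fst (fst (nuance F a)) \<le> n_out F l a \<and> n_out F l a < snd (fst (nuance F a))"

definition not_a :: "'a mma \<Rightarrow> 'a labelling \<Rightarrow> 'a \<Rightarrow> bool" where
  "not_a F l a \<longleftrightarrow> n_out F l a < fst (fst (nuance F a))"

definition may_r :: "'a mma \<Rightarrow> 'a labelling \<Rightarrow> 'a \<Rightarrow> bool" where
  "may_r F l a \<longleftrightarrow> fst (snd (nuance F a)) \<le> n_in F l a"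

definition must_r :: "'a mma \<Rightarrow> 'a labelling \<Rightarrow> 'a \<Rightarrow> bool" where
  "must_r F l a \<longleftrightarrow> snd (snd (nuance F a)) \<le> n_in F l a"

definition mays_r :: "'a mma \<Rightarrow> 'a labelling \<Rightarrow> 'a \<Rightarrow> bool" where
  "mays_r F l a \<longleftrightarrow>
     fst (snd (nuance F a)) \<le> n_in F l a \<and> n_in F l a < snd (snd (nuance F a))"

definition not_r :: "'a mma \<Rightarrow> 'a labelling \<Rightarrow> 'a \<Rightarrow> bool" where
  "not_r F l a \<longleftrightarrow> n_in F l a < fst (snd (nuance F a))"

definition mma_designates :: "'a mma \<Rightarrow> 'a labelling \<Rightarrow> label \<Rightarrow> 'a \<Rightarrow> bool" where
  "mma_designates F l x a \<longleftrightarrow> pre F a \<subseteq> dom l \<and>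
     (case x of
        In \<Rightarrow> may_a F l a \<and> \<not> must_r F l a
      | Out \<Rightarrow> may_r F l a \<and> \<not> must_a F l a
      | Undec \<Rightarrow> (must_a F l a \<and> must_r F l a) \<or> mays_a F l a \<or> mays_r F l a \<or>
                 (not_a F l a \<and> not_r F l a))"

definition adf_designates :: "'a adf \<Rightarrow> 'a labelling \<Rightarrow> label \<Rightarrow> 'a \<Rightarrow> bool" where
  "adf_designates G l x a \<longleftrightarrow> pre G a \<subseteq> dom l \<and> cond G a (l |` pre G a) = x"

definition max_labs :: "'a set \<Rightarrow> 'a labelling \<Rightarrow> 'a labelling set" where
  "max_labs A l = {lx \<in> labellings A. l \<preceq> lx \<and> (\<forall>l'\<in>labellings A. lx \<preceq> l' \<longrightarrow> l' = lx)}"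

text \<open>
  The operator and the semantics are stated once, for an argument set \<open>A\<close> and an arbitrary
  designation relation \<open>D\<close>, and then instantiated to both kinds of framework.
  On labellings of a finite \<open>A\<close> the set \<open>max_labs A l\<close> is nonempty, so the first two
  alternatives of \<open>Theta\<close> exclude each other; see \<open>Theta_eq_iff\<close>.
\<close>

definition forced :: "('a labelling \<Rightarrow> label \<Rightarrow> 'a \<Rightarrow> bool) \<Rightarrow> 'a set \<Rightarrow> 'a labelling \<Rightarrow>
    label \<Rightarrow> 'a \<Rightarrow> bool" where
  "forced D A l x a \<longleftrightarrow> (\<forall>lx\<in>max_labs A l. D lx x a \<and> (\<forall>y. y \<noteq> x \<longrightarrow> \<not> D lx y a))"

definition Theta :: "('a labelling \<Rightarrow> label \<Rightarrow> 'a \<Rightarrow> bool) \<Rightarrow> 'a set \<Rightarrow> 'a labelling \<Rightarrow>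
    'a labelling" where
  "Theta D A l = (\<lambda>a. if a \<in> A then
       Some (if forced D A l In a then In else if forced D A l Out a then Out else Undec)
     else None)"

definition grounded :: "('a labelling \<Rightarrow> label \<Rightarrow> 'a \<Rightarrow> bool) \<Rightarrow> 'a set \<Rightarrow> 'a labelling set" where
  "grounded D A = {l \<in> labellings A. Theta D A l = l \<and>
     (\<forall>l'\<in>labellings A. Theta D A l' = l' \<longrightarrow> l \<preceq> l')}"

definition mma_grounded :: "'a mma \<Rightarrow> 'a labelling set" where
  "mma_grounded F = grounded (mma_designates F) (args F)"

definition adf_grounded :: "'a adf \<Rightarrow> 'a labelling set" where
  "adf_grounded G = grounded (adf_designates G) (args G)"

lemma max_labs_nonempty:
  assumes "finite A" "l \<in> labellings A"
  shows "max_labs A l \<noteq> {}"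
proof -
  define m where "m = (\<lambda>a. if l a = Some Undec then Some In else l a)"
  have dm: "dom m = A" using assms by (auto simp: m_def labellings_def dom_def)
  have val: "m a = Some In \<or> m a = Some Out" if "a \<in> A" for a
  proof -
    obtain x where "l a = Some x" using assms \<open>a \<in> A\<close> unfolding labellings_def by blast
    then show ?thesis by (cases x) (auto simp: m_def)
  qed
  have le: "l \<preceq> m" using assms dm by (auto simp: lab_le_def labellings_def m_def)
  have "l' = m" if "l' \<in> labellings A" "m \<preceq> l'" for l'
  proof
    fix a
    have dl: "dom l' = A" using that by (simp add: labellings_def)
    show "l' a = m a"
    proof (cases "a \<in> A")
      case True
      then show ?thesis using val[OF True] that dm by (auto simp: lab_le_def)
    next
      case False
      then show ?thesis using dl dm by (metis domIff)
    qed
  qed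
  then have "m \<in> max_labs A l" using dm le by (simp add: max_labs_def labellings_def)
  then show ?thesis by blast
qed

lemma Theta_eq_iff:
  assumes "finite A" "l \<in> labellings A" "a \<in> A" "x \<in> {In, Out}"
  shows "Theta D A l a = Some x \<longleftrightarrow> forced D A l x a"
proof -
  have "\<not> (forced D A l In a \<and> forced D A l Out a)"
    using max_labs_nonempty[OF assms(1,2)] by (auto simp: forced_def)
  then show ?thesis using assms by (auto simp: Theta_def)
qed

definition abstractions :: "'a adf \<Rightarrow> 'a mma set" where
  "abstractions G = {F. is_mma F \<and> args F = args G \<and> att F = att G \<and>
     (\<forall>a\<in>args G. case nuance F a of ((n1, n2), (m1, m2)) \<Rightarrow>
        n2 \<le> card (pre G a) + 1 \<and> m2 \<le> card (pre G a) + 1 \<and>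
        (\<forall>l\<in>labellings (pre G a). let v = n_out G l a; w = n_in G l a; c = cond G a l in
           (v < n1 \<and> w < m1 \<longrightarrow> c = Undec) \<and>
           (n1 \<le> v \<and> v < n2 \<and> w < m1 \<longrightarrow> c \<in> {In, Undec}) \<and>
           (n2 \<le> v \<and> w < m1 \<longrightarrow> c = In) \<and>
           (v < n1 \<and> m1 \<le> w \<and> w < m2 \<longrightarrow> c \<in> {Out, Undec}) \<and>
           (n1 \<le> v \<and> v < n2 \<and> m1 \<le> w \<and> w < m2 \<longrightarrow> c \<in> {In, Out, Undec}) \<and>
           (n2 \<le> v \<and> m1 \<le> w \<and> w < m2 \<longrightarrow> c \<in> {In, Undec}) \<and>
           (v < n1 \<and> m2 \<le> w \<longrightarrow> c = Out) \<and>
           (n1 \<le> v \<and> v < n2 \<and> m2 \<le> w \<longrightarrow> c \<in> {Out, Undec}) \<and>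
           (n2 \<le> v \<and> m2 \<le> w \<longrightarrow> c = Undec)))}"

definition nuance_le :: "nuance \<Rightarrow> nuance \<Rightarrow> bool" (infix "\<unlhd>" 50) where
  "q \<unlhd> q' \<longleftrightarrow> (case (q, q') of (((n1, n2), (m1, m2)), ((n1', n2'), (m1', m2'))) \<Rightarrow>
     n1' \<le> n1 \<and> n2 \<le> n2' \<and> m1' \<le> m1 \<and> m2 \<le> m2')"

definition mma_le :: "'a mma \<Rightarrow> 'a mma \<Rightarrow> bool" (infix "\<sqsubseteq>" 50) where
  "F \<sqsubseteq> F' \<longleftrightarrow> args F = args F' \<and> att F = att F' \<and>
     (\<forall>a\<in>args F. nuance F a \<unlhd> nuance F' a)"

definition mma_less :: "'a mma \<Rightarrow> 'a mma \<Rightarrow> bool" (infix "\<sqsubset>" 50) where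
  "F' \<sqsubset> F \<longleftrightarrow> F' \<sqsubseteq> F \<and> \<not> F \<sqsubseteq> F'"

end

(* Whatever an abstraction F of G designates uniquely as In or Out is also designated by G, so
   the operator of F lies pointwise below the operator of G. Both operators are monotone, so the
   least fixpoint of F lies below every prefixed point of its operator, in particular below the
   least fixpoint of G. *)
theory Submission
  imports Defs
begin

lemma lab_le_refl: "finite (dom l) \<Longrightarrow> l \<preceq> l"
  by (simp add: lab_le_def)

lemma lab_le_trans: "l1 \<preceq> l2 \<Longrightarrow> l2 \<preceq> l3 \<Longrightarrow> l1 \<preceq> l3"
  by (auto simp: lab_le_def)

lemma Theta_labellings: "Theta D A l \<in> labellings A"
  by (auto simp: Theta_def labellings_def split: if_splits)

text \<open>Only the values \<open>In\<close> and \<open>Out\<close> count in \<preceq>, and by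
  \<open>Theta_eq_iff\<close> the operator takes them exactly where they are forced.\<close>

lemma Theta_leI:
  assumes "finite A" "l \<in> labellings A" "l' \<in> labellings A"
    and "\<And>a x. a \<in> A \<Longrightarrow> x \<in> {In, Out} \<Longrightarrow> forced D A l x a \<Longrightarrow> forced D' A l' x a"
  shows "Theta D A l \<preceq> Theta D' A l'"
proof -
  have "Theta D' A l' a = Some x" if "Theta D A l a = Some x" "a \<in> A" "x \<in> {In, Out}" for a x
    using that assms Theta_eq_iff by metis
  moreover have "dom (Theta D A l) = A" "dom (Theta D' A l') = A"
    using Theta_labellings[of D A l] Theta_labellings[of D' A l'] by (simp_all add: labellings_def)
  ultimately show ?thesis
    using \<open>finite A\<close> by (simp add: lab_le_def)
qed

text \<open>A larger labelling has fewer maximal completions, by transitivity of \<preceq>, so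
  whatever is forced stays forced.\<close>

lemma Theta_mono:
  assumes "finite A" "l \<in> labellings A" "l' \<in> labellings A" "l \<preceq> l'"
  shows "Theta D A l \<preceq> Theta D A l'"
proof (rule Theta_leI[OF assms(1-3)])
  have "max_labs A l' \<subseteq> max_labs A l"
    using \<open>l \<preceq> l'\<close> lab_le_trans by (auto simp: max_labs_def)
  then show "forced D A l' x a" if "forced D A l x a" for a x
    using that by (auto simp: forced_def)
qed

text \<open>The size of this set serves as a rank on labellings of a finite set.\<close>

definition decided :: "'a labelling \<Rightarrow> 'a set" where
  "decided l = {a. l a = Some In \<or> l a = Some Out}"

lemma decided_subset_dom: "decided l \<subseteq> dom l"
  by (auto simp: decided_def)

text \<open>Going up in \<preceq> can only enlarge the finite set of decided arguments. If its size
  does not grow, the set is the same, and the rest of the common domain is \<open>Undec\<close> on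
  both sides.\<close>

lemma lab_le_eqI:
  assumes "l \<preceq> l'" "card (decided l') \<le> card (decided l)"
  shows "l' = l"
proof
  fix a
  have dom: "dom l' = dom l" "finite (dom l)"
    using \<open>l \<preceq> l'\<close> by (auto simp: lab_le_def)
  have "decided l \<subseteq> decided l'"
    using \<open>l \<preceq> l'\<close> by (auto simp: lab_le_def decided_def dom_def)
  moreover have "finite (decided l')"
    using decided_subset_dom[of l'] dom finite_subset by auto
  ultimately have "decided l = decided l'"
    using assms(2) card_seteq by blast
  then have eq: "a \<in> decided l \<longleftrightarrow> a \<in> decided l'" by simp
  show "l' a = l a"
  proof (cases "l a")
    case None
    then show ?thesis using dom by (metis domIff)
  next
    case (Some x)
    then obtain y where "l' a = Some y" using dom by blast
    then show ?thesis
      using Some eq \<open>l \<preceq> l'\<close>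
      by (cases x; cases y) (auto simp: decided_def lab_le_def dom_def)
  qed
qed

text \<open>Finiteness replaces a complete lattice: among the labellings below their own image and
  below all prefixed points, one with the most decided arguments cannot be raised by
  \<open>Theta\<close>.\<close>

lemma Theta_least_prefixpoint:
  assumes "finite A"
  obtains l where "l \<in> labellings A" "Theta D A l = l"
    "\<And>p. p \<in> labellings A \<Longrightarrow> Theta D A p \<preceq> p \<Longrightarrow> l \<preceq> p"
proof -
  define P where "P l \<longleftrightarrow> l \<in> labellings A \<and> l \<preceq> Theta D A l \<and>
    (\<forall>p\<in>labellings A. Theta D A p \<preceq> p \<longrightarrow> l \<preceq> p)" for l
  \<comment> \<open>The bottom element of \<preceq> on labellings of \<open>A\<close> shows that
    \<open>P\<close> is satisfiable.\<close>
  have "P (\<lambda>a. if a \<in> A then Some Undec else None)"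
    using assms Theta_labellings[of D A]
    by (auto simp: P_def lab_le_def labellings_def dom_def)
  \<comment> \<open>At most \<open>card A\<close> arguments are decided; \<open>Suc\<close> turns
    this into a strict bound, which yields a maximum.\<close>
  moreover have "card (decided l) < Suc (card A)" if "P l" for l
    using that assms card_mono[OF assms, of "decided l"] decided_subset_dom[of l]
    by (simp add: P_def labellings_def less_Suc_eq_le)
  ultimately obtain l where l: "P l" "\<And>l'. P l' \<Longrightarrow> card (decided l') \<le> card (decided l)"
    using ex_has_greatest_nat[of P _ "card \<circ> decided" "Suc (card A)"] by (metis comp_apply)
  \<comment> \<open>\<open>P\<close> is closed under the operator by monotonicity; for prefixed
    \<open>p\<close>, the image of \<open>l\<close> lies below the image of \<open>p\<close>, hence
    below \<open>p\<close>.\<close>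
  have "P (Theta D A l)"
    unfolding P_def
  proof (intro conjI ballI impI)
    show "Theta D A l \<preceq> Theta D A (Theta D A l)"
      using Theta_mono[OF assms _ Theta_labellings] l(1) by (simp add: P_def)
    show "Theta D A l \<preceq> p" if "p \<in> labellings A" "Theta D A p \<preceq> p" for p
      using Theta_mono[OF assms, of l p] that l(1) lab_le_trans by (auto simp: P_def)
  qed (rule Theta_labellings)
  then have "Theta D A l = l"
    using l lab_le_eqI by (auto simp: P_def)
  then show thesis
    using that l(1) by (auto simp: P_def)
qed

lemma grounded_lab_le:
  assumes "finite A"
    and forced: "\<And>l a x. a \<in> A \<Longrightarrow> x \<in> {In, Out} \<Longrightarrow> forced D A l x a \<Longrightarrow> forced D' A l x a"
    and l: "l \<in> grounded D A"
  shows "\<exists>l'\<in>grounded D' A. l \<preceq> l'"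
proof -
  \<comment> \<open>\<open>l\<close> is given as least among fixpoints only; \<open>m\<close> is a
    fixpoint that also lies below all prefixed points, so it links \<open>l\<close> to
    \<open>l'\<close>.\<close>
  obtain m where m: "m \<in> labellings A" "Theta D A m = m"
    "\<And>p. p \<in> labellings A \<Longrightarrow> Theta D A p \<preceq> p \<Longrightarrow> m \<preceq> p"
    using Theta_least_prefixpoint[OF \<open>finite A\<close>] by metis
  obtain l' where l': "l' \<in> labellings A" "Theta D' A l' = l'"
    "\<And>p. p \<in> labellings A \<Longrightarrow> Theta D' A p \<preceq> p \<Longrightarrow> l' \<preceq> p"
    using Theta_least_prefixpoint[OF \<open>finite A\<close>] by metis
  have "p \<preceq> p" if "p \<in> labellings A" for p
    using that \<open>finite A\<close> by (simp add: lab_le_refl labellings_def)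
  then have "l' \<in> grounded D' A"
    using l' by (simp add: grounded_def)
  \<comment> \<open>By \<open>forced\<close>, the first operator stays below the second at
    \<open>l'\<close>, which the second one fixes.\<close>
  moreover have "Theta D A l' \<preceq> l'"
    using Theta_leI[OF \<open>finite A\<close> l'(1) l'(1), of D D'] forced l'(2) by simp
  then have "m \<preceq> l'" using m l' by blast
  moreover have "l \<preceq> m" using l m by (simp add: grounded_def)
  ultimately show ?thesis using lab_le_trans by blast
qed

text \<open>Lets \<open>cond\<close>, which is evaluated on a labelling restricted to the
  predecessors, be matched with the counts in the unrestricted labelling.\<close>

lemma n_out_restrict:
  assumes "pre Y a = pre Z a"
  shows "n_out Y (l |` pre Z a) a = n_out Z l a"
  unfolding n_out_def by (rule arg_cong[of _ _ card]) (auto simp: assms)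

lemma n_in_restrict:
  assumes "pre Y a = pre Z a"
  shows "n_in Y (l |` pre Z a) a = n_in Z l a"
  unfolding n_in_def by (rule arg_cong[of _ _ card]) (auto simp: assms)

text \<open>Excluding \<open>Undec\<close> leaves only the two corners, must-accept with not-reject
  and not-accept with must-reject, and there an abstraction prescribes a single value of
  \<open>cond\<close>.\<close>

lemma abstraction_unique_designation:
  assumes "F \<in> abstractions G" "a \<in> args G" "x \<in> {In, Out}"
    and des: "mma_designates F l x a" and uniq: "\<And>y. y \<noteq> x \<Longrightarrow> \<not> mma_designates F l y a"
  shows "adf_designates G l x a"
proof -
  obtain n1 n2 m1 m2 where q: "nuance F a = ((n1, n2), (m1, m2))"
    by (metis surj_pair)
  have pre: "pre G a = pre F a"
    using assms(1) by (simp add: abstractions_def pre_def)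
  have sub: "pre F a \<subseteq> dom l"
    using des by (simp add: mma_designates_def)
  then have lab: "l |` pre F a \<in> labellings (pre G a)"
    using pre by (auto simp: labellings_def)
  have cond: "(n2 \<le> n_out F l a \<and> n_in F l a < m1 \<longrightarrow> cond G a (l |` pre F a) = In) \<and>
    (n_out F l a < n1 \<and> m2 \<le> n_in F l a \<longrightarrow> cond G a (l |` pre F a) = Out)"
  proof -
    have "\<forall>k\<in>labellings (pre G a).
        (n2 \<le> n_out G k a \<and> n_in G k a < m1 \<longrightarrow> cond G a k = In) \<and>
        (n_out G k a < n1 \<and> m2 \<le> n_in G k a \<longrightarrow> cond G a k = Out)"
      using assms(1,2) q unfolding abstractions_def Let_def mem_Collect_eq
      by (metis (mono_tags, lifting) case_prod_conv)
    then show ?thesis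
      using lab n_out_restrict[OF pre, of l] n_in_restrict[OF pre, of l] by metis
  qed
  have undec: "\<not> mma_designates F l Undec a"
    using uniq \<open>x \<in> {In, Out}\<close> by auto
  have "cond G a (l |` pre F a) = x"
  proof (cases "x = In")
    case True
    \<comment> \<open>\<open>In\<close> gives may-accept and no must-reject; since both intermediate
      ranges would designate \<open>Undec\<close>, these sharpen to must-accept and
      not-reject.\<close>
    have "n2 \<le> n_out F l a \<and> n_in F l a < m1"
      using des undec True q
      by (auto simp: mma_designates_def may_a_def must_a_def mays_a_def must_r_def mays_r_def
          not_a_def not_r_def)
    then show ?thesis using cond True by blast
  next
    case False
    then have "x = Out" using \<open>x \<in> {In, Out}\<close> by simp
    then have "n_out F l a < n1 \<and> m2 \<le> n_in F l a"
      using des undec q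
      by (auto simp: mma_designates_def may_r_def must_a_def mays_a_def must_r_def mays_r_def
          not_a_def not_r_def)
    then show ?thesis using cond \<open>x = Out\<close> by blast
  qed
  then show ?thesis using sub pre by (simp add: adf_designates_def)
qed

theorem mainTheorem9:
  fixes G :: "'a adf" and F :: "'a mma"
  assumes "is_adf G"
    and "F \<in> abstractions G"
    and "\<not> (\<exists>F'\<in>abstractions G. F' \<sqsubset> F)"
  shows "\<forall>l\<in>mma_grounded F. \<exists>l'\<in>adf_grounded G. l \<preceq> l'"
proof -
  have "args F = args G"
    using assms(2) by (simp add: abstractions_def)
  \<comment> \<open>Uniqueness on the side of \<open>G\<close> is automatic, because
    \<open>cond\<close> is a function.\<close>
  moreover have "forced (adf_designates G) (args G) l x a"
    if "a \<in> args G" "x \<in> {In, Out}" "forced (mma_designates F) (args G) l x a" for l x a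
    using that abstraction_unique_designation[OF assms(2)]
    by (auto simp: forced_def adf_designates_def)
  ultimately show ?thesis
    using grounded_lab_le[of "args G" "mma_designates F" "adf_designates G"] assms(1)
    by (auto simp: mma_grounded_def adf_grounded_def is_adf_def)
qed

end
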